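(* Let $\mathcal{H}$ be a complex infinite-dimensional Hilbert space and let $\mathbf{T}=(T_1,T_2)$ be a commuting pair of bounded linear operators on $\mathcal{H}$, with spherical Aluthge transform $\widehat{\mathbf{T}}$. Then $\mathbf{T}$ is (Taylor) invertible if and only if $\widehat{\mathbf{T}}$ is (Taylor) invertible.
   Context: Canonical joint polar decomposition: for a commuting pair $\mathbf{T}=(T_1,T_2)$ of bounded operators on $\mathcal{H}$, consider the polar decomposition of the column operator $\begin{pmatrix} T_1 \\ T_2 \end{pmatrix}:\mathcal{H}\to\mathcal{H}\oplus\mathcal{H}$, namely $\begin{pmatrix} T_1 \\ T_2 \end{pmatrix}=\begin{pmatrix} V_1 \\ V_2 \end{pmatrix}P$, where $P=\sqrt{T_1^*T_1+T_2^*T_2}$ and $\begin{pmatrix} V_1 \\ V_2 \end{pmatrix}:\mathcal{H}\to\mathcal{H}\oplus\mathcal{H}$ is a partial isometry, subject to $\ker T_1\cap\ker T_2=\ker V_1\cap\ker V_2=\ker P$. The spherical Aluthge transform of $\mathbf{T}$ is $\widehat{\mathbf{T}}:=(\sqrt{P}V_1\sqrt{P},\sqrt{P}V_2\sqrt{P})$, which is necessarily a commuting pair. For a commuting pair $\mathbf{S}=(S_1,S_2)$ on $\mathcal{H}$, the Koszul complex $K(\mathbf{S},\mathcal{H})$ is $$0\to\mathcal{H}\xrightarrow{\begin{pmatrix} S_1 \\ S_2 \end{pmatrix}}\mathcal{H}\oplus\mathcal{H}\xrightarrow{(-S_2\ \ S_1)}\mathcal{H}\to 0.$$ The pair $\mathbf{S}$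 is (Taylor) invertible if $K(\mathbf{S},\mathcal{H})$ is exact. *)

theory Defs
  imports "HOL-Analysis.Analysis"
begin

class scaleC =
  fixes scaleC :: "complex \<Rightarrow> 'a \<Rightarrow> 'a" (infixr "*\<^sub>C" 75)

class complex_vector = real_vector + scaleC +
  assumes scaleC_add_right: "a *\<^sub>C (x + y) = a *\<^sub>C x + a *\<^sub>C y"
    and scaleC_add_left: "(a + b) *\<^sub>C x = a *\<^sub>C x + b *\<^sub>C x"
    and scaleC_scaleC: "a *\<^sub>C b *\<^sub>C x = (a * b) *\<^sub>C x"
    and scaleC_one: "1 *\<^sub>C x = x"
    and scaleR_scaleC: "r *\<^sub>R x = complex_of_real r *\<^sub>C x"

global_interpretation complex_vector:
  vector_space "scaleC :: complex \<Rightarrow> 'a \<Rightarrow> 'a::complex_vector"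
  by unfold_locales (simp_all add: scaleC_add_right scaleC_add_left scaleC_scaleC scaleC_one)

text \<open>The inner product is linear in its first argument. Since \<^const>\<open>norm\<close> is a norm,
  \<open>cinner_self\<close> makes the inner product positive definite and says that it induces the norm.\<close>

class complex_inner = complex_vector + real_normed_vector +
  fixes cinner :: "'a \<Rightarrow> 'a \<Rightarrow> complex"
  assumes cinner_commute: "cinner x y = cnj (cinner y x)"
    and cinner_add_left: "cinner (x + y) z = cinner x z + cinner y z"
    and cinner_scaleC_left: "cinner (c *\<^sub>C x) y = c * cinner x y"
    and cinner_self: "cinner x x = complex_of_real ((norm x)\<^sup>2)"

class complex_hilbert_space = complex_inner + banach

text \<open>The Hilbert space direct sum: the library norm on pairs is already the Hilbertian one.\<close>

instantiation prod :: (complex_vector, complex_vector) complex_vector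
begin

definition scaleC_prod :: "complex \<Rightarrow> 'a \<times> 'b \<Rightarrow> 'a \<times> 'b"
  where "scaleC_prod c z = (c *\<^sub>C fst z, c *\<^sub>C snd z)"

instance
  by standard
    (simp_all add: scaleC_prod_def prod_eq_iff scaleC_add_right scaleC_add_left
      scaleC_scaleC scaleC_one scaleR_scaleC)

end

instantiation prod :: (complex_inner, complex_inner) complex_inner
begin

definition cinner_prod :: "'a \<times> 'b \<Rightarrow> 'a \<times> 'b \<Rightarrow> complex"
  where "cinner_prod z w = cinner (fst z) (fst w) + cinner (snd z) (snd w)"

instance
proof
  fix x y z :: "'a \<times> 'b" and c :: complex
  show "cinner x y = cnj (cinner y x)"
    unfolding cinner_prod_def complex_cnj_add
    using cinner_commute[of "fst x" "fst y"] cinner_commute[of "snd x" "snd y"] by simp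
  show "cinner (x + y) z = cinner x z + cinner y z"
    by (simp add: cinner_prod_def cinner_add_left)
  show "cinner (c *\<^sub>C x) y = c * cinner x y"
    by (simp add: cinner_prod_def scaleC_prod_def cinner_scaleC_left algebra_simps)
  show "cinner x x = complex_of_real ((norm x)\<^sup>2)"
    by (simp add: cinner_prod_def cinner_self norm_prod_def)
qed

end

instance prod :: (complex_hilbert_space, complex_hilbert_space) complex_hilbert_space ..

definition bounded_clinear :: "('a::complex_inner \<Rightarrow> 'b::complex_inner) \<Rightarrow> bool"
  where "bounded_clinear A \<longleftrightarrow> bounded_linear A \<and> (\<forall>c x. A (c *\<^sub>C x) = c *\<^sub>C A x)"

definition kernel :: "('a \<Rightarrow> 'b::zero) \<Rightarrow> 'a set"
  where "kernel A = {x. A x = 0}"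

text \<open>For bounded operators between Hilbert spaces the adjoint exists and is unique; the same
  holds below for the positive square root of a positive operator and for the joint polar
  decomposition. The choice operator thus denotes the unique such object in each case.\<close>

definition cadjoint :: "('a::complex_inner \<Rightarrow> 'b::complex_inner) \<Rightarrow> 'b \<Rightarrow> 'a"
  where "cadjoint A = (SOME B. \<forall>x y. cinner (A x) y = cinner x (B y))"

definition positive_op :: "('a::complex_inner \<Rightarrow> 'a) \<Rightarrow> bool"
  where "positive_op A \<longleftrightarrow> bounded_clinear A \<and> (\<forall>x. cinner (A x) x \<in> \<real>\<^sub>\<ge>\<^sub>0)"

definition sqrt_op :: "('a::complex_inner \<Rightarrow> 'a) \<Rightarrow> 'a \<Rightarrow> 'a"
  where "sqrt_op A = (SOME R. positive_op R \<and> R \<circ> R = A)"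

definition partial_isometry :: "('a::complex_inner \<Rightarrow> 'b::complex_inner) \<Rightarrow> bool"
  where "partial_isometry W \<longleftrightarrow> bounded_clinear W \<and>
    (\<forall>x. (\<forall>y\<in>kernel W. cinner x y = 0) \<longrightarrow> norm (W x) = norm x)"

type_synonym 'a op_pair = "('a \<Rightarrow> 'a) \<times> ('a \<Rightarrow> 'a)"

definition commuting_pair :: "'a::complex_inner op_pair \<Rightarrow> bool"
  where "commuting_pair T \<longleftrightarrow> bounded_clinear (fst T) \<and> bounded_clinear (snd T) \<and>
    fst T \<circ> snd T = snd T \<circ> fst T"

definition column :: "'a op_pair \<Rightarrow> 'a \<Rightarrow> 'a \<times> 'a"
  where "column T x = (fst T x, snd T x)"

definition koszul_row :: "'a::complex_inner op_pair \<Rightarrow> 'a \<times> 'a \<Rightarrow> 'a"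
  where "koszul_row S z = - snd S (fst z) + fst S (snd z)"

definition taylor_invertible :: "'a::complex_inner op_pair \<Rightarrow> bool"
  where "taylor_invertible S \<longleftrightarrow>
    kernel (column S) = {0} \<and>
    range (column S) = kernel (koszul_row S) \<and>
    range (koszul_row S) = UNIV"

definition joint_modulus :: "'a::complex_inner op_pair \<Rightarrow> 'a \<Rightarrow> 'a"
  where "joint_modulus T =
    sqrt_op (\<lambda>x. cadjoint (fst T) (fst T x) + cadjoint (snd T) (snd T x))"

definition joint_polar_decomposition ::
    "'a::complex_inner op_pair \<Rightarrow> 'a op_pair \<Rightarrow> ('a \<Rightarrow> 'a) \<Rightarrow> bool"
  where "joint_polar_decomposition T V P \<longleftrightarrow>
    P = joint_modulus T \<and>
    partial_isometry (column V) \<and>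
    column T = column V \<circ> P \<and>
    kernel (fst T) \<inter> kernel (snd T) = kernel (fst V) \<inter> kernel (snd V) \<and>
    kernel (fst V) \<inter> kernel (snd V) = kernel P"

definition spherical_aluthge :: "'a::complex_inner op_pair \<Rightarrow> 'a op_pair"
  where "spherical_aluthge T =
    (let (V, P) = (SOME (V, P). joint_polar_decomposition T V P);
         Q = sqrt_op P
     in (Q \<circ> fst V \<circ> Q, Q \<circ> snd V \<circ> Q))"

end

theory Submission
  imports Defs
begin

text \<open>Write \<open>P\<close> for the joint modulus and \<open>Q\<close> for its square root. If \<open>Q\<close> is bijective, then
  \<open>Q V\<^sub>i Q \<circ> Q = Q \<circ> T\<^sub>i\<close>, so that \<open>Q\<close> intertwines the two Koszul complexes and the equivalence is
  purely algebraic. If the Aluthge transform is invertible, \<open>Q\<close> is injective because each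
  \<open>Q V\<^sub>i Q\<close> vanishes on its kernel, and surjective because it is a left factor of the last Koszul
  map. If \<open>T\<close> is invertible, its column is injective with closed range; since it has the same
  norms as \<open>P\<close>, the positive operator \<open>P = Q\<^sup>2\<close> is also injective with closed range, hence bijective.
  The rest is the Hilbert space theory needed to know that adjoints, positive square roots and
  polar decompositions exist.\<close>

section \<open>Projections, Riesz representation and adjoints\<close>

lemma cinner_add_right: "cinner x (y + z) = cinner x y + cinner x (z::'a::complex_inner)"
  by (metis cinner_add_left cinner_commute complex_cnj_add)

lemma cinner_scaleC_right: "cinner x (c *\<^sub>C y) = cnj c * cinner x (y::'a::complex_inner)"
  by (metis cinner_commute cinner_scaleC_left complex_cnj_mult)

lemma cinner_zero_left [simp]: "cinner 0 (x::'a::complex_inner) = 0"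
  using cinner_add_left[of 0 0 x] by simp

lemma cinner_zero_right [simp]: "cinner (x::'a::complex_inner) 0 = 0"
  using cinner_add_right[of x 0 0] by simp

lemma cinner_minus_left: "cinner (- x) (y::'a::complex_inner) = - cinner x y"
  using cinner_add_left[of x "- x" y] by (simp add: eq_neg_iff_add_eq_0 add.commute)

lemma cinner_minus_right: "cinner x (- y) = - cinner x (y::'a::complex_inner)"
  using cinner_add_right[of x y "- y"] by (simp add: eq_neg_iff_add_eq_0 add.commute)

lemma cinner_diff_left: "cinner (x - y) z = cinner x z - cinner y (z::'a::complex_inner)"
  using cinner_add_left[of x "- y" z] by (simp add: cinner_minus_left)

lemma cinner_diff_right: "cinner x (y - z) = cinner x y - cinner x (z::'a::complex_inner)"
  using cinner_add_right[of x y "- z"] by (simp add: cinner_minus_right)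

lemma cinner_scaleR_left: "cinner (r *\<^sub>R x) y = of_real r * cinner x (y::'a::complex_inner)"
  by (simp add: scaleR_scaleC cinner_scaleC_left)

lemma cinner_scaleR_right: "cinner x (r *\<^sub>R y) = of_real r * cinner x (y::'a::complex_inner)"
  by (simp add: scaleR_scaleC cinner_scaleC_right)

lemma cinner_self_eq_0_iff [simp]: "cinner x x = 0 \<longleftrightarrow> x = (0::'a::complex_inner)"
  by (simp add: cinner_self)

lemma cinner_eq_0_commute: "cinner x y = 0 \<longleftrightarrow> cinner y (x::'a::complex_inner) = 0"
  by (metis cinner_commute complex_cnj_zero)

lemma cinner_ext:
  assumes "\<And>z. cinner x z = cinner y (z::'a::complex_inner)"
  shows "x = y"
  using assms[of "x - y"] cinner_self_eq_0_iff[of "x - y"] by (simp add: cinner_diff_left)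

lemma norm_diff_cinner:
  "(norm (x - y))\<^sup>2 = (norm x)\<^sup>2 + (norm y)\<^sup>2 - 2 * Re (cinner x (y::'a::complex_inner))"
proof -
  have "complex_of_real ((norm (x - y))\<^sup>2) = cinner (x - y) (x - y)"
    by (simp add: cinner_self)
  also have "\<dots> = cinner x x + cinner y y - (cinner x y + cnj (cinner x y))"
    using cinner_commute[of y x] by (simp add: cinner_diff_left cinner_diff_right)
  also have "\<dots> = complex_of_real ((norm x)\<^sup>2 + (norm y)\<^sup>2 - 2 * Re (cinner x y))"
    by (simp add: cinner_self complex_add_cnj)
  finally show ?thesis
    using of_real_eq_iff by blast
qed

lemma parallelogram:
  "(norm (x + y))\<^sup>2 + (norm (x - y))\<^sup>2 = 2 * (norm x)\<^sup>2 + 2 * (norm (y::'a::complex_inner))\<^sup>2"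
  using norm_diff_cinner[of x y] norm_diff_cinner[of x "- y"] by (simp add: cinner_minus_right)

lemma norm_scaleC: "norm (c *\<^sub>C x) = cmod c * norm (x::'a::complex_inner)"
proof -
  have "complex_of_real ((norm (c *\<^sub>C x))\<^sup>2) = (c * cnj c) * cinner x x"
    unfolding cinner_self[symmetric] by (simp add: cinner_scaleC_left cinner_scaleC_right)
  also have "\<dots> = of_real ((cmod c * norm x)\<^sup>2)"
    unfolding complex_norm_square[of c, symmetric] cinner_self by (simp add: power_mult_distrib)
  finally have "complex_of_real ((norm (c *\<^sub>C x))\<^sup>2) = of_real ((cmod c * norm x)\<^sup>2)" .
  then have "(norm (c *\<^sub>C x))\<^sup>2 = (cmod c * norm x)\<^sup>2"
    using of_real_eq_iff by blast
  then show ?thesis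
    by (simp add: power2_eq_iff_nonneg)
qed

text \<open>Pythagoras: the subtracted multiple of \<open>y\<close> is the orthogonal projection of
  \<open>x\<close> onto the line spanned by \<open>y\<close>. Nonnegativity of the right side is
  Cauchy-Schwarz; its drop below \<open>(norm x)\<^sup>2\<close> drives the projection
  theorem.\<close>

lemma norm_diff_scaleC_projection:
  fixes x y :: "'a::complex_inner"
  assumes "y \<noteq> 0"
  shows "(norm (x - (cinner x y / of_real ((norm y)\<^sup>2)) *\<^sub>C y))\<^sup>2
    = (norm x)\<^sup>2 - (cmod (cinner x y))\<^sup>2 / (norm y)\<^sup>2"
proof -
  let ?c = "cinner x y" and ?n = "(norm y)\<^sup>2"
  have "cnj (?c / of_real ?n) * ?c = of_real ((cmod ?c)\<^sup>2 / ?n)"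
    using complex_norm_square[of ?c] by simp
  moreover have "(cmod (?c / of_real ?n) * norm y)\<^sup>2 = (cmod ?c)\<^sup>2 / ?n"
    using assms by (simp add: power_mult_distrib power_divide norm_divide norm_power)
      (simp add: power2_eq_square power4_eq_xxxx)
  ultimately show ?thesis
    by (simp add: norm_diff_cinner norm_scaleC cinner_scaleC_right del: complex_cnj_divide)
qed

lemma cinner_Cauchy_Schwarz: "cmod (cinner x y) \<le> norm x * norm (y::'a::complex_inner)"
proof (cases "y = 0")
  case False
  have "(cmod (cinner x y))\<^sup>2 / (norm y)\<^sup>2 \<le> (norm x)\<^sup>2"
    using norm_diff_scaleC_projection[OF False, of x]
      zero_le_power2[of "norm (x - (cinner x y / of_real ((norm y)\<^sup>2)) *\<^sub>C y)"] by linarith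
  then have "(cmod (cinner x y))\<^sup>2 \<le> (norm x * norm y)\<^sup>2"
    using False by (simp add: divide_le_eq power_mult_distrib)
  then show ?thesis
    by (rule power2_le_imp_le) simp
qed simp

lemma bounded_bilinear_cinner:
  "bounded_bilinear (cinner :: 'a::complex_inner \<Rightarrow> 'a \<Rightarrow> complex)"
proof
  show "\<exists>K. \<forall>a b. norm (cinner a (b::'a)) \<le> norm a * norm b * K"
    by (intro exI[of _ 1] allI) (simp add: cinner_Cauchy_Schwarz)
qed (simp_all add: cinner_add_left cinner_add_right cinner_scaleR_left cinner_scaleR_right
    scaleR_conv_of_real)

lemmas tendsto_cinner = bounded_bilinear.tendsto[OF bounded_bilinear_cinner]

lemma bounded_linear_scaleC: "bounded_linear (\<lambda>x::'a::complex_inner. c *\<^sub>C x)"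
proof (rule bounded_linear_intro[of _ "cmod c"])
  show "c *\<^sub>C (r *\<^sub>R x) = r *\<^sub>R c *\<^sub>C x" for r and x :: 'a
    by (simp add: scaleR_scaleC scaleC_scaleC mult.commute)
qed (simp_all add: scaleC_add_right norm_scaleC mult.commute)

lemmas tendsto_scaleC = bounded_linear.tendsto[OF bounded_linear_scaleC]

section \<open>Bounded complex-linear maps\<close>

lemma bounded_clinearD:
  assumes "bounded_clinear A"
  shows "bounded_linear A" "A (c *\<^sub>C x) = c *\<^sub>C A x"
  using assms by (auto simp: bounded_clinear_def)

lemma bounded_clinear_simps:
  assumes "bounded_clinear A"
  shows "A (x + y) = A x + A y" "A (x - y) = A x - A y" "A (- x) = - A x" "A 0 = 0"
    "A (r *\<^sub>R x) = r *\<^sub>R A x"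
proof -
  interpret bounded_linear A using bounded_clinearD(1)[OF assms] .
  show "A (x + y) = A x + A y" "A (x - y) = A x - A y" "A (- x) = - A x" "A 0 = 0"
    "A (r *\<^sub>R x) = r *\<^sub>R A x"
    by (simp_all add: add diff neg zero scaleR)
qed

section \<open>Orthogonal projections onto closed subspaces\<close>

lemma minimizing_vector_exists:
  fixes M :: "'a::complex_hilbert_space set"
  assumes M: "complex_vector.subspace M" "closed M"
  obtains m where "m \<in> M" "\<And>y. y \<in> M \<Longrightarrow> norm (x - m) \<le> norm (x - y)"
proof -
  define d where "d = infdist x M"
  have ne: "M \<noteq> {}"
    using complex_vector.subspace_0[OF M(1)] by auto
  have d0: "0 \<le> d"
    by (simp add: d_def infdist_nonneg)
  have dle: "d \<le> norm (x - y)" if "y \<in> M" for y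
    using infdist_le[OF that, of x] by (simp add: d_def dist_norm)
  have "\<exists>m\<in>M. (norm (x - m))\<^sup>2 < d\<^sup>2 + e" if "e > 0" for e
  proof -
    have "d < sqrt (d\<^sup>2 + e)"
      using that d0 by (simp add: real_less_rsqrt)
    then obtain m where "m \<in> M" "dist x m < sqrt (d\<^sup>2 + e)"
      using ne unfolding d_def infdist_def by (auto simp: cINF_less_iff)
    moreover from this have "(norm (x - m))\<^sup>2 < (sqrt (d\<^sup>2 + e))\<^sup>2"
      by (intro power_strict_mono) (auto simp: dist_norm)
    ultimately show ?thesis
      using that by (auto simp: add_nonneg_nonneg less_imp_le)
  qed
  then have "\<forall>n::nat. \<exists>m\<in>M. (norm (x - m))\<^sup>2 < d\<^sup>2 + inverse (real (Suc n))"
    by (metis inverse_positive_iff_positive of_nat_0_less_iff zero_less_Suc)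
  then obtain m where mM: "\<And>n. m n \<in> M"
    and m: "\<And>n. (norm (x - m n))\<^sup>2 < d\<^sup>2 + inverse (real (Suc n))"
    by metis
  \<comment> \<open>The midpoint of \<open>m i\<close> and \<open>m j\<close> lies in the subspace,
    so its distance from \<open>x\<close> is at least \<open>d\<close>; the parallelogram law then
    turns near-minimality of both points into closeness.\<close>
  have close: "(norm (m i - m j))\<^sup>2 \<le> 2 * inverse (real (Suc i)) + 2 * inverse (real (Suc j))" for i j
  proof -
    have "(1/2) *\<^sub>R (m i + m j) \<in> M"
      using mM M(1) by (simp add: scaleR_scaleC complex_vector.subspace_add complex_vector.subspace_scale)
    then have "d\<^sup>2 \<le> (norm (x - (1/2) *\<^sub>R (m i + m j)))\<^sup>2"
      using dle d0 by (intro power_mono) auto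
    moreover have "(x - m i) + (x - m j) = 2 *\<^sub>R (x - (1/2) *\<^sub>R (m i + m j))"
      by (simp add: algebra_simps scaleR_2)
    then have "(norm ((x - m i) + (x - m j)))\<^sup>2 = 4 * (norm (x - (1/2) *\<^sub>R (m i + m j)))\<^sup>2"
      by (simp add: power_mult_distrib)
    moreover have "norm ((x - m i) - (x - m j)) = norm (m i - m j)"
      by (simp add: norm_minus_commute)
    ultimately show ?thesis
      using parallelogram[of "x - m i" "x - m j"] m[of i] m[of j] by simp
  qed
  have "Cauchy m"
  proof (rule CauchyI)
    fix e :: real assume "0 < e"
    then obtain N where N: "inverse (real (Suc N)) < e\<^sup>2 / 4"
      using reals_Archimedean[of "e\<^sup>2 / 4"] by auto
    have "norm (m i - m j) < e" if "i \<ge> N" "j \<ge> N" for i j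
    proof -
      have "inverse (real (Suc i)) \<le> inverse (real (Suc N))"
        "inverse (real (Suc j)) \<le> inverse (real (Suc N))"
        using that by (auto intro!: le_imp_inverse_le)
      then have "(norm (m i - m j))\<^sup>2 < e\<^sup>2"
        using close[of i j] N by linarith
      then show ?thesis
        using \<open>0 < e\<close> by (intro power_less_imp_less_base[of _ 2 e]) auto
    qed
    then show "\<exists>M. \<forall>i\<ge>M. \<forall>j\<ge>M. norm (m i - m j) < e"
      by blast
  qed
  then obtain l where l: "m \<longlonglongrightarrow> l"
    using Cauchy_convergent_iff convergent_def by blast
  have "(norm (x - l))\<^sup>2 \<le> d\<^sup>2"
  proof (rule LIMSEQ_le)
    show "(\<lambda>n. (norm (x - m n))\<^sup>2) \<longlonglongrightarrow> (norm (x - l))\<^sup>2"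
      by (intro tendsto_intros l)
    show "(\<lambda>n. d\<^sup>2 + inverse (real (Suc n))) \<longlonglongrightarrow> d\<^sup>2"
      using LIMSEQ_inverse_real_of_nat_add by blast
    show "\<exists>N. \<forall>n\<ge>N. (norm (x - m n))\<^sup>2 \<le> d\<^sup>2 + inverse (real (Suc n))"
      using m less_imp_le by blast
  qed
  then have "norm (x - l) \<le> d"
    using d0 power2_le_imp_le by blast
  moreover have "l \<in> M"
    using closed_sequentially[OF M(2) mM l] .
  ultimately show thesis
    using that dle order_trans by blast
qed

text \<open>A minimizer works: were \<open>x - m\<close> not orthogonal to some \<open>y\<close> in
  \<open>M\<close>, shifting \<open>m\<close> along \<open>y\<close> by the projection coefficient
  would strictly reduce the distance.\<close>

theorem projection_exists:
  fixes M :: "'a::complex_hilbert_space set"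
  assumes M: "complex_vector.subspace M" "closed M"
  obtains m where "m \<in> M" "\<And>y. y \<in> M \<Longrightarrow> cinner (x - m) y = 0"
proof -
  obtain m where m: "m \<in> M" and min: "\<And>y. y \<in> M \<Longrightarrow> norm (x - m) \<le> norm (x - y)"
    using minimizing_vector_exists[OF M] by blast
  have "cinner (x - m) y = 0" if "y \<in> M" for y
  proof (cases "y = 0")
    case False
    let ?t = "cinner (x - m) y / of_real ((norm y)\<^sup>2)"
    have "m + ?t *\<^sub>C y \<in> M"
      using M(1) m that by (intro complex_vector.subspace_add complex_vector.subspace_scale)
    then have "(norm (x - m))\<^sup>2 \<le> (norm (x - m - ?t *\<^sub>C y))\<^sup>2"
      using min by (simp add: diff_diff_add power_mono)
    then have "(cmod (cinner (x - m) y))\<^sup>2 / (norm y)\<^sup>2 \<le> 0"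
      using norm_diff_scaleC_projection[OF False, of "x - m"] by linarith
    then show ?thesis
      using False by (simp add: divide_le_0_iff)
  qed simp
  with m show thesis
    using that by blast
qed

corollary closed_subspace_eq_UNIV:
  fixes M :: "'a::complex_hilbert_space set"
  assumes M: "complex_vector.subspace M" "closed M"
    and orth: "\<And>x. (\<And>y. y \<in> M \<Longrightarrow> cinner x y = 0) \<Longrightarrow> x = 0"
  shows "M = UNIV"
proof -
  have "x \<in> M" for x
    using projection_exists[OF M] orth by (metis eq_iff_diff_eq_0)
  then show ?thesis by auto
qed

section \<open>Riesz representation and adjoints\<close>

theorem Riesz_representation:
  fixes f :: "'a::complex_hilbert_space \<Rightarrow> complex"
  assumes f: "bounded_linear f" and fC: "\<And>c x. f (c *\<^sub>C x) = c * f x"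
  obtains z where "\<And>x. f x = cinner x z"
proof (cases "\<forall>x. f x = 0")
  case True
  then show thesis using that[of 0] by simp
next
  case False
  interpret bounded_linear f by fact
  obtain x where x: "f x \<noteq> 0" using False by blast
  let ?M = "{x. f x = 0}"
  have "complex_vector.subspace ?M"
    by (rule complex_vector.subspaceI) (simp_all add: zero add fC)
  moreover have "closed ?M"
    by (intro closed_Collect_eq continuous_on continuous_intros)
  ultimately obtain m where m: "f m = 0" and n: "\<And>y. f y = 0 \<Longrightarrow> cinner (x - m) y = 0"
    using projection_exists[of ?M x] by auto
  \<comment> \<open>\<open>n\<close> is a nonzero normal to the kernel of \<open>f\<close>; a
    suitable multiple of it represents \<open>f\<close>.\<close>
  define n where "n = x - m"
  have fn: "f n \<noteq> 0"
    using x m by (simp add: n_def diff)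
  then have n0: "n \<noteq> 0"
    using zero by auto
  have "f y = cinner y ((cnj (f n) / of_real ((norm n)\<^sup>2)) *\<^sub>C n)" for y
  proof -
    \<comment> \<open>A multiple of \<open>n\<close> corrects \<open>y\<close> into the kernel;
      orthogonality to \<open>n\<close> then expresses \<open>f y\<close> through
      \<open>cinner y n\<close>.\<close>
    have "f (y - (f y / f n) *\<^sub>C n) = 0"
      using fn by (simp add: diff fC)
    then have "cinner (y - (f y / f n) *\<^sub>C n) n = 0"
      using n cinner_eq_0_commute unfolding n_def by blast
    then have "cinner y n = (f y / f n) * of_real ((norm n)\<^sup>2)"
      by (simp add: cinner_diff_left cinner_scaleC_left cinner_self)
    then show ?thesis
      using fn n0 by (simp add: cinner_scaleC_right)
  qed
  then show thesis using that by blast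
qed

text \<open>Riesz representation, applied for each fixed \<open>y\<close> to the functional
  \<open>cinner (A x) y\<close>, supplies the witness that the choice in \<open>cadjoint\<close>
  requires.\<close>

lemma cadjoint:
  fixes A :: "'a::complex_hilbert_space \<Rightarrow> 'b::complex_inner"
  assumes A: "bounded_clinear A"
  shows "cinner (A x) y = cinner x (cadjoint A y)"
proof -
  have "\<exists>z. \<forall>x. cinner (A x) y = cinner x z" for y
  proof -
    have "bounded_linear (\<lambda>x. cinner (A x) y)"
      using bounded_linear_compose[OF bounded_bilinear.bounded_linear_left[OF bounded_bilinear_cinner]
          bounded_clinearD(1)[OF A]] .
    then show ?thesis
      using Riesz_representation[of "\<lambda>x. cinner (A x) y"]
      by (metis A bounded_clinearD(2) cinner_scaleC_left)
  qed
  then have "\<exists>B. \<forall>x y. cinner (A x) y = cinner x (B y)"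
    by metis
  then have "\<forall>x y. cinner (A x) y = cinner x (cadjoint A y)"
    unfolding cadjoint_def by (rule someI_ex)
  then show ?thesis by blast
qed

text \<open>Testing against all vectors gives linearity. For the bound, the square of
  \<open>norm (cadjoint A y)\<close> equals \<open>cinner y (A (cadjoint A y))\<close>;
  Cauchy-Schwarz and cancelling one factor leave the bound \<open>K\<close> of
  \<open>A\<close>.\<close>

lemma bounded_clinear_cadjoint:
  fixes A :: "'a::complex_hilbert_space \<Rightarrow> 'b::complex_inner"
  assumes A: "bounded_clinear A"
  shows "bounded_clinear (cadjoint A)"
proof -
  have adj: "cinner (cadjoint A y) x = cinner y (A x)" for x y
    by (metis cadjoint[OF A] cinner_commute)
  have scaleC: "cadjoint A (c *\<^sub>C y) = c *\<^sub>C cadjoint A y" for c y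
    by (rule cinner_ext) (simp add: adj cinner_scaleC_left)
  obtain K where K: "0 \<le> K" "\<And>x. norm (A x) \<le> norm x * K"
    using bounded_linear.nonneg_bounded[OF bounded_clinearD(1)[OF A]] by blast
  have "bounded_linear (cadjoint A)"
  proof (rule bounded_linear_intro[of _ K])
    show "cadjoint A (x + y) = cadjoint A x + cadjoint A y" for x y
      by (rule cinner_ext) (simp add: adj cinner_add_left)
    show "cadjoint A (r *\<^sub>R y) = r *\<^sub>R cadjoint A y" for r y
      by (simp add: scaleR_scaleC scaleC)
    show "norm (cadjoint A y) \<le> norm y * K" for y
    proof (cases "cadjoint A y = 0")
      case False
      let ?z = "cadjoint A y"
      have "norm ?z * norm ?z = cmod (cinner y (A ?z))"
        by (simp add: adj[symmetric] cinner_self power2_eq_square norm_mult)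
      also have "\<dots> \<le> norm y * (norm ?z * K)"
        using cinner_Cauchy_Schwarz[of y "A ?z"] K(2)[of ?z]
        by (meson mult_left_mono norm_ge_zero order_trans)
      finally show ?thesis
        using False by (simp add: mult.left_commute)
    qed (simp add: K)
  qed
  then show ?thesis
    by (simp add: bounded_clinear_def scaleC)
qed

section \<open>Positive square roots\<close>

text \<open>Polarization: \<open>d\<close> is a sesquilinear form vanishing on the diagonal, which
  over the complex numbers forces it to vanish.\<close>

lemma positive_op_symmetric:
  assumes A: "positive_op A"
  shows "cinner (A x) y = cinner x (A y)"
proof -
  have lin: "bounded_clinear A"
    using A by (simp add: positive_op_def)
  define d where "d u v = cinner (A u) v - cinner u (A v)" for u v
  have d0: "d u u = 0" for u
  proof -
    have "cinner (A u) u \<in> \<real>"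
      using A nonneg_Reals_subset_Reals by (auto simp: positive_op_def)
    then show ?thesis
      using cinner_commute[of u "A u"] by (simp add: d_def Reals_cnj_iff)
  qed
  have add: "d (u + v) (u + v) = d u u + d u v + d v u + d v v" for u v
    by (simp add: d_def bounded_clinear_simps[OF lin] cinner_add_left cinner_add_right)
  \<comment> \<open>Replacing \<open>y\<close> by \<open>\<i> *\<^sub>C y\<close> turns the
    vanishing sum \<open>d x y + d y x\<close> into a vanishing difference, so both terms are
    zero.\<close>
  have "d x (\<i> *\<^sub>C y) = - \<i> * d x y" "d (\<i> *\<^sub>C y) x = \<i> * d y x"
    by (simp_all add: d_def bounded_clinearD[OF lin] cinner_scaleC_left cinner_scaleC_right
        right_diff_distrib)
  then have "\<i> * (d y x - d x y) = 0"
    using add[of x "\<i> *\<^sub>C y"] d0 by (simp add: algebra_simps)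
  moreover have "d x y + d y x = 0"
    using add[of x y] d0 by simp
  ultimately have "d x y = 0"
    by simp
  then show ?thesis
    by (simp add: d_def)
qed

text \<open>A square root of \<open>1 - B\<close> is \<open>1 - Y\<close> for a fixed point \<open>Y\<close> of \<open>Y \<mapsto> (B + Y\<^sup>2) / 2\<close>; the
  iteration for the scalar \<open>B = 1\<close> dominates all others with \<open>norm B \<le> 1\<close>.\<close>

primrec sqrt_iter :: "('a::real_normed_vector \<Rightarrow>\<^sub>L 'a) \<Rightarrow> nat \<Rightarrow> 'a \<Rightarrow>\<^sub>L 'a" where
  "sqrt_iter B 0 = 0"
| "sqrt_iter B (Suc n) = (1/2) *\<^sub>R (B + (sqrt_iter B n o\<^sub>L sqrt_iter B n))"

primrec sqrt_majorant :: "nat \<Rightarrow> real" where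
  "sqrt_majorant 0 = 0"
| "sqrt_majorant (Suc n) = (1 + (sqrt_majorant n)\<^sup>2) / 2"

section \<open>Convergence of the square root iteration\<close>

lemma sqrt_majorant_bounds: "0 \<le> sqrt_majorant n" "sqrt_majorant n \<le> 1"
  by (induction n) (simp_all add: power_le_one)

lemma convergent_sqrt_majorant: "convergent sqrt_majorant"
proof (rule Bseq_mono_convergent)
  show "Bseq sqrt_majorant"
    using sqrt_majorant_bounds by (intro BseqI'[of _ 1]) simp
  \<comment> \<open>The increment is half the square of \<open>sqrt_majorant n - 1\<close>.\<close>
  have "sqrt_majorant n \<le> sqrt_majorant (Suc n)" for n
    using zero_le_power2[of "sqrt_majorant n - 1"] by (simp add: power2_diff)
  then show "\<forall>m n. m \<le> n \<longrightarrow> sqrt_majorant m \<le> sqrt_majorant n"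
    using lift_Suc_mono_le by blast
qed

lemma norm_sqrt_iter_le:
  assumes "norm B \<le> 1"
  shows "norm (sqrt_iter B n) \<le> sqrt_majorant n"
proof (induction n)
  case (Suc n)
  let ?Y = "sqrt_iter B n"
  have "norm (?Y o\<^sub>L ?Y) \<le> (sqrt_majorant n)\<^sup>2"
    using norm_blinfun_compose[of ?Y ?Y] Suc sqrt_majorant_bounds
    by (smt (verit) mult_mono norm_ge_zero power2_eq_square)
  then show ?case
    using norm_triangle_ineq[of B "?Y o\<^sub>L ?Y"] assms by simp
qed simp

text \<open>Squares differ by \<open>Z Z - Y Y = Z (Z - Y) + (Z - Y) Y\<close>, valid without
  commutativity; the majorant obeys the same identity for numbers, so the bound propagates by
  induction.\<close>

lemma norm_sqrt_iter_diff_le: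
  assumes B: "norm B \<le> 1"
  shows "norm (sqrt_iter B (Suc n) - sqrt_iter B n) \<le> sqrt_majorant (Suc n) - sqrt_majorant n"
proof (induction n)
  case 0
  then show ?case using assms by simp
next
  case (Suc n)
  let ?Y = "sqrt_iter B n" and ?Z = "sqrt_iter B (Suc n)"
  let ?y = "sqrt_majorant n" and ?z = "sqrt_majorant (Suc n)"
  have split: "sqrt_iter B (Suc (Suc n)) - ?Z = (1/2) *\<^sub>R ((?Z o\<^sub>L (?Z - ?Y)) + ((?Z - ?Y) o\<^sub>L ?Y))"
  proof -
    have "sqrt_iter B (Suc (Suc n)) - ?Z = (1/2) *\<^sub>R ((?Z o\<^sub>L ?Z) - (?Y o\<^sub>L ?Y))"
      unfolding sqrt_iter.simps(2)[of B "Suc n"]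
      by (simp only: sqrt_iter.simps(2)[of B n] scaleR_diff_right[symmetric] add_diff_cancel_left)
    then show ?thesis
      by (simp only: bounded_bilinear.diff_left[OF bounded_bilinear_blinfun_compose]
        bounded_bilinear.diff_right[OF bounded_bilinear_blinfun_compose]) simp
  qed
  have "norm (?Z o\<^sub>L (?Z - ?Y)) \<le> norm ?Z * norm (?Z - ?Y)"
    by (rule norm_blinfun_compose)
  also have "\<dots> \<le> ?z * (?z - ?y)"
    by (intro mult_mono norm_sqrt_iter_le[OF B] Suc sqrt_majorant_bounds norm_ge_zero)
  finally have 1: "norm (?Z o\<^sub>L (?Z - ?Y)) \<le> ?z * (?z - ?y)" .
  have "norm ((?Z - ?Y) o\<^sub>L ?Y) \<le> norm (?Z - ?Y) * norm ?Y"
    by (rule norm_blinfun_compose)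
  also have "\<dots> \<le> (?z - ?y) * ?y"
    using Suc norm_ge_zero[of "?Z - ?Y"]
    by (intro mult_mono norm_sqrt_iter_le[OF B] norm_ge_zero) linarith+
  finally have 2: "norm ((?Z - ?Y) o\<^sub>L ?Y) \<le> (?z - ?y) * ?y" .
  have "norm (sqrt_iter B (Suc (Suc n)) - ?Z) \<le> (?z * (?z - ?y) + (?z - ?y) * ?y) / 2"
    unfolding split using 1 2 norm_triangle_ineq[of "?Z o\<^sub>L (?Z - ?Y)" "(?Z - ?Y) o\<^sub>L ?Y"]
    by (simp del: sqrt_iter.simps sqrt_majorant.simps)
  also have "\<dots> = sqrt_majorant (Suc (Suc n)) - ?z"
    by (simp only: sqrt_majorant.simps(2)[of "Suc n"] field_simps power2_eq_square)
      (simp add: field_simps power2_eq_square)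
  finally show ?case .
qed

text \<open>The increments are dominated by those of the convergent majorant, whose telescoping
  series is summable; completeness then gives convergence in operator norm.\<close>

lemma convergent_sqrt_iter:
  fixes B :: "'a::banach \<Rightarrow>\<^sub>L 'a"
  assumes B: "norm B \<le> 1"
  shows "convergent (sqrt_iter B)"
proof -
  obtain l where "sqrt_majorant \<longlonglongrightarrow> l"
    using convergent_sqrt_majorant convergent_def by blast
  then have "summable (\<lambda>n. sqrt_majorant (Suc n) - sqrt_majorant n)"
    by (rule telescope_summable)
  then have "summable (\<lambda>n. sqrt_iter B (Suc n) - sqrt_iter B n)"
    by (rule summable_comparison_test'[where N = 0]) (rule norm_sqrt_iter_diff_le[OF B])
  then have "convergent (\<lambda>n. \<Sum>i<n. sqrt_iter B (Suc i) - sqrt_iter B i)"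
    by (simp only: summable_iff_convergent)
  then show ?thesis
    by (simp only: sum_lessThan_telescope sqrt_iter.simps(1) diff_zero)
qed

text \<open>Elements of \<open>\<Rightarrow>\<^sub>L\<close> are only real-linear by type, so
  complex homogeneity is carried through the iterates separately and later passed to the
  limit.\<close>

lemma sqrt_iter_scaleC:
  assumes "\<And>x. blinfun_apply B (c *\<^sub>C x) = c *\<^sub>C B (x::'a::complex_inner)"
  shows "sqrt_iter B n (c *\<^sub>C x) = c *\<^sub>C sqrt_iter B n x"
  by (induction n arbitrary: x)
    (simp_all add: blinfun.bilinear_simps assms scaleC_add_right scaleR_scaleC mult.commute)

lemma sqrt_iter_symmetric:
  assumes "\<And>x y. cinner (blinfun_apply B x) y = cinner x (B (y::'a::complex_inner))"
  shows "cinner (sqrt_iter B n x) y = cinner x (sqrt_iter B n y)"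
  by (induction n arbitrary: x y)
    (simp_all add: blinfun.bilinear_simps assms cinner_add_left cinner_add_right
      cinner_scaleR_left cinner_scaleR_right)

section \<open>Existence of positive square roots\<close>

lemma positive_opI_contraction:
  fixes Y :: "'a::complex_inner \<Rightarrow> 'a"
  assumes Y: "bounded_clinear Y" and sym: "\<And>x y. cinner (Y x) y = cinner x (Y y)"
    and le: "\<And>x. norm (Y x) \<le> norm x"
  shows "positive_op (\<lambda>x. x - Y x)"
  unfolding positive_op_def
proof safe
  show "bounded_clinear (\<lambda>x. x - Y x)"
    using Y unfolding bounded_clinear_def
    by (auto intro: bounded_linear_sub bounded_linear_ident simp: complex_vector.scale_right_diff_distrib)
  fix x
  \<comment> \<open>Cauchy-Schwarz and contractivity bound the real part of the form; symmetry
    removes the imaginary part.\<close>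
  have "Re (cinner (Y x) x) \<le> norm (Y x) * norm x"
    using complex_Re_le_cmod cinner_Cauchy_Schwarz order_trans by blast
  also have "\<dots> \<le> (norm x)\<^sup>2"
    using le[of x] by (simp add: power2_eq_square mult_right_mono)
  finally have "Re (cinner (Y x) x) \<le> (norm x)\<^sup>2" .
  moreover have "Im (cinner (Y x) x) = 0"
    by (metis cinner_commute sym Reals_cnj_iff complex_is_Real_iff)
  ultimately show "cinner (x - Y x) x \<in> \<real>\<^sub>\<ge>\<^sub>0"
    by (simp add: complex_nonneg_Reals_iff cinner_diff_left cinner_self)
qed

text \<open>Testing positivity of \<open>A\<close> at \<open>x - A x\<close> and using contractivity
  at \<open>A x\<close> yields \<open>(norm (A x))\<^sup>2 \<le> Re (cinner x (A x))\<close>;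
  expanding \<open>(norm (x - A x))\<^sup>2\<close> finishes.\<close>

lemma contraction_one_minus_positive:
  fixes A :: "'a::complex_inner \<Rightarrow> 'a"
  assumes A: "positive_op A" and le: "\<And>x. norm (A x) \<le> norm x"
  shows "norm (x - A x) \<le> norm x"
proof -
  have lin: "bounded_clinear A"
    using A by (simp add: positive_op_def)
  have "0 \<le> Re (cinner (A (x - A x)) (x - A x))"
    using A by (simp add: positive_op_def complex_nonneg_Reals_iff)
  also have "\<dots> = Re (cinner (A x) x) - 2 * (norm (A x))\<^sup>2 + Re (cinner (A (A x)) (A x))"
    using positive_op_symmetric[OF A, of "A x" x]
    by (simp add: bounded_clinear_simps[OF lin] cinner_diff_left cinner_diff_right cinner_self)
  finally have "2 * (norm (A x))\<^sup>2 \<le> Re (cinner (A x) x) + Re (cinner (A (A x)) (A x))"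
    by simp
  moreover have "Re (cinner (A (A x)) (A x)) \<le> norm (A (A x)) * norm (A x)"
    using complex_Re_le_cmod cinner_Cauchy_Schwarz order_trans by blast
  moreover have "norm (A (A x)) * norm (A x) \<le> (norm (A x))\<^sup>2"
    using le[of "A x"] by (simp add: power2_eq_square mult_right_mono)
  ultimately have "(norm (A x))\<^sup>2 \<le> Re (cinner x (A x))"
    unfolding positive_op_symmetric[OF A, of x x] by linarith
  then have "(norm (x - A x))\<^sup>2 \<le> (norm x)\<^sup>2"
    using zero_le_power2[of "norm (A x)"] unfolding norm_diff_cinner by linarith
  then show ?thesis
    by (rule power2_le_imp_le) simp
qed

text \<open>The iteration runs on \<open>B = 1 - A\<close>; its limit \<open>Y\<close> inherits
  homogeneity, symmetry and contractivity, and \<open>1 - Y\<close> is the root.\<close>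

lemma positive_sqrt_exists_contraction:
  fixes A :: "'a::complex_hilbert_space \<Rightarrow> 'a"
  assumes A: "positive_op A" and le: "\<And>x. norm (A x) \<le> norm x"
  shows "\<exists>R. positive_op R \<and> R \<circ> R = A"
proof -
  have lin: "bounded_clinear A"
    using A by (simp add: positive_op_def)
  define B where "B = Blinfun (\<lambda>x. x - A x)"
  have B: "blinfun_apply B = (\<lambda>x. x - A x)"
    unfolding B_def using bounded_clinearD(1)[OF lin]
    by (intro bounded_linear_Blinfun_apply bounded_linear_sub bounded_linear_ident)
  have norm_B: "norm B \<le> 1"
    using contraction_one_minus_positive[OF A le] by (intro norm_blinfun_bound) (simp_all add: B)
  have B_scaleC: "B (c *\<^sub>C x) = c *\<^sub>C B x" for c x
    by (simp add: B bounded_clinearD(2)[OF lin] complex_vector.scale_right_diff_distrib)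
  have B_sym: "cinner (B x) y = cinner x (B y)" for x y
    by (simp add: B cinner_diff_left cinner_diff_right positive_op_symmetric[OF A])
  obtain Y where Y: "sqrt_iter B \<longlonglongrightarrow> Y"
    using convergent_sqrt_iter[OF norm_B] convergent_def by blast
  have lim: "(\<lambda>n. sqrt_iter B n x) \<longlonglongrightarrow> Y x" for x
    by (intro blinfun.tendsto Y tendsto_const)
  have "(\<lambda>n. sqrt_iter B (Suc n)) \<longlonglongrightarrow> (1/2) *\<^sub>R (B + (Y o\<^sub>L Y))"
    unfolding sqrt_iter.simps
    by (intro tendsto_intros Y bounded_bilinear.tendsto[OF bounded_bilinear_blinfun_compose])
  then have fixpoint: "Y = (1/2) *\<^sub>R (B + (Y o\<^sub>L Y))"
    using LIMSEQ_unique LIMSEQ_Suc[OF Y] by blast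
  \<comment> \<open>The fixed-point equation rearranged: it says pointwise that the square of
    \<open>1 - Y\<close> is \<open>A\<close>.\<close>
  have YY: "Y (Y x) = 2 *\<^sub>R Y x - x + A x" for x
  proof -
    have "2 *\<^sub>R Y x = B x + Y (Y x)"
      by (subst fixpoint) (simp add: blinfun.bilinear_simps)
    then show ?thesis
      by (simp add: B)
  qed
  have "Y (c *\<^sub>C x) = c *\<^sub>C Y x" for c x
    using lim[of "c *\<^sub>C x"] tendsto_scaleC[OF lim[of x], of c]
    by (simp add: sqrt_iter_scaleC[OF B_scaleC] LIMSEQ_unique)
  then have "bounded_clinear (blinfun_apply Y)"
    by (simp add: bounded_clinear_def blinfun.bounded_linear_right)
  moreover have "cinner (Y x) y = cinner x (Y y)" for x y
    using tendsto_cinner[OF lim[of x] tendsto_const[of y]]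
      tendsto_cinner[OF tendsto_const[of x] lim[of y]]
    by (simp add: sqrt_iter_symmetric[OF B_sym] LIMSEQ_unique)
  moreover have "norm (Y x) \<le> norm x" for x
  proof -
    have "norm Y \<le> 1"
      using norm_sqrt_iter_le[OF norm_B] sqrt_majorant_bounds(2) order_trans
      by (intro LIMSEQ_le_const2[OF tendsto_norm[OF Y]]) blast
    then show ?thesis
      using norm_blinfun[of Y x] mult_right_mono[of "norm Y" 1 "norm x"] by simp
  qed
  ultimately have "positive_op (\<lambda>x. x - Y x)"
    by (rule positive_opI_contraction)
  moreover have "(\<lambda>x. x - Y x) \<circ> (\<lambda>x. x - Y x) = A"
    by (rule ext) (simp add: blinfun.bilinear_simps YY scaleR_2)
  ultimately show ?thesis by blast
qed

lemma positive_op_scaleR: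
  assumes A: "positive_op A" and c: "0 \<le> c"
  shows "positive_op (\<lambda>x. c *\<^sub>R A x)"
  using assms bounded_linear_compose[OF bounded_linear_scaleR_right, of A c]
  unfolding positive_op_def bounded_clinear_def
  by (simp add: scaleR_scaleC mult.commute cinner_scaleC_left complex_nonneg_Reals_iff)

text \<open>Rescaling: dividing by a positive bound \<open>K\<close> gives a contraction, whose root
  is then multiplied by \<open>sqrt K\<close>.\<close>

theorem positive_sqrt_exists:
  fixes A :: "'a::complex_hilbert_space \<Rightarrow> 'a"
  assumes A: "positive_op A"
  shows "\<exists>R. positive_op R \<and> R \<circ> R = A"
proof -
  have "bounded_linear A"
    using A by (simp add: positive_op_def bounded_clinear_def)
  then obtain K where K: "0 < K" "\<And>x. norm (A x) \<le> norm x * K"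
    using bounded_linear.pos_bounded by blast
  have "positive_op (\<lambda>x. inverse K *\<^sub>R A x)"
    using A K(1) by (intro positive_op_scaleR) auto
  moreover have "norm (inverse K *\<^sub>R A x) \<le> norm x" for x
    using K(1) K(2)[of x] by (simp add: field_simps)
  ultimately obtain R where R: "positive_op R" "R \<circ> R = (\<lambda>x. inverse K *\<^sub>R A x)"
    using positive_sqrt_exists_contraction by blast
  have "(\<lambda>x. sqrt K *\<^sub>R R x) \<circ> (\<lambda>x. sqrt K *\<^sub>R R x) = A"
  proof
    fix x
    have "R (R x) = inverse K *\<^sub>R A x"
      using R(2) by (metis comp_apply)
    moreover have "R (sqrt K *\<^sub>R y) = sqrt K *\<^sub>R R y" for y
      using R(1) by (simp add: positive_op_def bounded_clinear_simps)
    ultimately show "((\<lambda>x. sqrt K *\<^sub>R R x) \<circ> (\<lambda>x. sqrt K *\<^sub>R R x)) x = A x"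
      using K(1) real_sqrt_mult_self[of K] by (simp add: mult.assoc[symmetric])
  qed
  moreover have "positive_op (\<lambda>x. sqrt K *\<^sub>R R x)"
    using R(1) K(1) by (intro positive_op_scaleR) auto
  ultimately show ?thesis by blast
qed

lemma sqrt_op:
  fixes A :: "'a::complex_hilbert_space \<Rightarrow> 'a"
  assumes "positive_op A"
  shows "positive_op (sqrt_op A)" "sqrt_op A (sqrt_op A x) = A x"
proof -
  have "positive_op (sqrt_op A) \<and> sqrt_op A \<circ> sqrt_op A = A"
    unfolding sqrt_op_def using positive_sqrt_exists[OF assms] by (rule someI_ex)
  then show "positive_op (sqrt_op A)" "sqrt_op A (sqrt_op A x) = A x"
    by (auto dest: fun_cong)
qed

section \<open>Polar decomposition\<close>

text \<open>Symmetry moves \<open>P\<close> across the inner product. This converts orthogonality to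
  the range into kernel membership, both for the partial isometry and for surjectivity of the joint
  modulus.\<close>

lemma positive_op_kernel_iff:
  assumes P: "positive_op P"
  shows "P x = 0 \<longleftrightarrow> (\<forall>w. cinner x (P w) = 0)"
  by (metis P positive_op_symmetric cinner_self_eq_0_iff cinner_zero_left)

lemma subspace_closure:
  fixes M :: "'a::complex_inner set"
  assumes M: "complex_vector.subspace M"
  shows "complex_vector.subspace (closure M)"
proof (rule complex_vector.subspaceI)
  show "0 \<in> closure M"
    using complex_vector.subspace_0[OF M] closure_subset by blast
  show "x + y \<in> closure M" if xy: "x \<in> closure M" "y \<in> closure M" for x y
  proof -
    obtain u v where "\<forall>n::nat. u n \<in> M" "u \<longlonglongrightarrow> x" "\<forall>n::nat. v n \<in> M" "v \<longlonglongrightarrow> y"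
      using xy unfolding closure_sequential by blast
    then have "\<forall>n. u n + v n \<in> M" "(\<lambda>n. u n + v n) \<longlonglongrightarrow> x + y"
      using complex_vector.subspace_add[OF M] by (auto intro: tendsto_add)
    then show ?thesis
      unfolding closure_sequential by (intro exI conjI)
  qed
  show "c *\<^sub>C x \<in> closure M" if x: "x \<in> closure M" for c x
  proof -
    obtain u where "\<forall>n::nat. u n \<in> M" "u \<longlonglongrightarrow> x"
      using x unfolding closure_sequential by blast
    then have "\<forall>n. c *\<^sub>C u n \<in> M" "(\<lambda>n. c *\<^sub>C u n) \<longlonglongrightarrow> c *\<^sub>C x"
      using complex_vector.subspace_scale[OF M] by (auto intro: tendsto_scaleC)
    then show ?thesis
      unfolding closure_sequential by (intro exI conjI)
  qed
qed

lemma subspace_range: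
  assumes A: "bounded_clinear A"
  shows "complex_vector.subspace (range A)"
  by (rule complex_vector.subspaceI)
    (auto simp: image_iff bounded_clinear_simps[OF A, symmetric] bounded_clinearD(2)[OF A, symmetric]
      intro: bounded_clinear_simps(4)[OF A, symmetric])

text \<open>The graph of the partial isometry \<open>W\<close> with \<open>S = W \<circ> P\<close>: here \<open>m\<close> is the orthogonal
  projection of \<open>y\<close> onto the closure of the range of \<open>P\<close>.\<close>

definition polar_graph ::
    "('a::complex_inner \<Rightarrow> 'a) \<Rightarrow> ('a \<Rightarrow> 'b::complex_inner) \<Rightarrow> 'a \<Rightarrow> 'a \<Rightarrow> 'b \<Rightarrow> bool"
  where "polar_graph P S y m z \<longleftrightarrow> (\<forall>w. cinner (y - m) (P w) = 0) \<and>
    (\<exists>x. (\<lambda>n. P (x n)) \<longlonglongrightarrow> m \<and> (\<lambda>n. S (x n)) \<longlonglongrightarrow> z)"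

lemma bounded_clinear_injI:
  assumes A: "bounded_clinear A" and ker: "\<And>x. A x = 0 \<Longrightarrow> x = 0"
  shows "inj A"
proof (rule injI)
  fix x y assume "A x = A y"
  then have "A (x - y) = 0"
    by (simp add: bounded_clinear_simps(2)[OF A])
  then show "x = y"
    using ker by fastforce
qed

text \<open>The graph is a complex subspace. The case \<open>c = -1\<close> serves uniqueness of
  \<open>m\<close> and \<open>z\<close>, general \<open>c\<close> the linearity of the resulting
  map.\<close>

lemma polar_graph_add_scaleC:
  assumes P: "bounded_clinear P" and S: "bounded_clinear S"
    and "polar_graph P S y m z" "polar_graph P S y' m' z'"
  shows "polar_graph P S (y + c *\<^sub>C y') (m + c *\<^sub>C m') (z + c *\<^sub>C z')"
proof -
  obtain x x' where lim: "(\<lambda>n. P (x n)) \<longlonglongrightarrow> m" "(\<lambda>n. S (x n)) \<longlonglongrightarrow> z"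
      "(\<lambda>n. P (x' n)) \<longlonglongrightarrow> m'" "(\<lambda>n. S (x' n)) \<longlonglongrightarrow> z'"
    using assms(3,4) unfolding polar_graph_def by blast
  have "(\<lambda>n. P (x n + c *\<^sub>C x' n)) \<longlonglongrightarrow> m + c *\<^sub>C m'" "(\<lambda>n. S (x n + c *\<^sub>C x' n)) \<longlonglongrightarrow> z + c *\<^sub>C z'"
    by (simp_all add: bounded_clinear_simps[OF P] bounded_clinear_simps[OF S]
        bounded_clinearD(2)[OF P] bounded_clinearD(2)[OF S] lim tendsto_add tendsto_scaleC)
  moreover have "y + c *\<^sub>C y' - (m + c *\<^sub>C m') = (y - m) + c *\<^sub>C (y' - m')"
    by (simp add: complex_vector.scale_right_diff_distrib)
  then have "cinner (y + c *\<^sub>C y' - (m + c *\<^sub>C m')) (P w) = 0" for w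
    using assms(3,4) unfolding polar_graph_def by (simp only: cinner_add_left cinner_scaleC_left) simp
  ultimately show ?thesis
    unfolding polar_graph_def by (intro conjI allI exI[of _ "\<lambda>n. x n + c *\<^sub>C x' n"])
qed

lemma polar_graph_orthogonal:
  assumes "polar_graph P S y m z"
  shows "cinner (y - m) m = 0"
proof -
  obtain x where "(\<lambda>n. P (x n)) \<longlonglongrightarrow> m"
    using assms unfolding polar_graph_def by blast
  then have "(\<lambda>n. cinner (y - m) (P (x n))) \<longlonglongrightarrow> cinner (y - m) m"
    by (intro tendsto_cinner tendsto_const)
  then show ?thesis
    using assms unfolding polar_graph_def by (simp add: LIMSEQ_const_iff)
qed

text \<open>Equal norms of \<open>S\<close> and \<open>P\<close> pass to the limits; the second
  bound is Pythagoras for \<open>y = (y - m) + m\<close>.\<close>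

lemma polar_graph_norm:
  assumes norm: "\<And>x. norm (S x) = norm (P x)" and G: "polar_graph P S y m z"
  shows "norm z = norm m" "norm z \<le> norm y"
proof -
  obtain x where "(\<lambda>n. P (x n)) \<longlonglongrightarrow> m" "(\<lambda>n. S (x n)) \<longlonglongrightarrow> z"
    using G unfolding polar_graph_def by blast
  then have "(\<lambda>n. norm (P (x n))) \<longlonglongrightarrow> norm m" "(\<lambda>n. norm (S (x n))) \<longlonglongrightarrow> norm z"
    by (auto intro: tendsto_norm)
  then show eq: "norm z = norm m"
    unfolding norm by (rule LIMSEQ_unique[rotated])
  have "(norm y)\<^sup>2 = (norm (y - m))\<^sup>2 + (norm m)\<^sup>2"
    using norm_diff_cinner[of "y - m" "- m"] polar_graph_orthogonal[OF G]
    by (simp add: cinner_minus_right)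
  then show "norm z \<le> norm y"
    by (simp add: eq power2_le_imp_le)
qed

text \<open>Projecting onto the closure of the range gives \<open>m\<close>. Along any
  \<open>x n\<close> with \<open>P (x n)\<close> tending to \<open>m\<close>, equality of norms
  makes \<open>S (x n)\<close> Cauchy, and its limit is \<open>z\<close>.\<close>

lemma polar_graph_exists:
  fixes P :: "'a::complex_hilbert_space \<Rightarrow> 'a" and S :: "'a \<Rightarrow> 'b::complex_hilbert_space"
  assumes P: "bounded_clinear P" and S: "bounded_clinear S"
    and norm: "\<And>x. norm (S x) = norm (P x)"
  shows "\<exists>m z. polar_graph P S y m z"
proof -
  obtain m where m: "m \<in> closure (range P)"
    and orth: "\<And>v. v \<in> closure (range P) \<Longrightarrow> cinner (y - m) v = 0"
    using projection_exists[OF subspace_closure[OF subspace_range[OF P]] closed_closure] by metis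
  obtain u where "\<forall>n::nat. u n \<in> range P" "u \<longlonglongrightarrow> m"
    using m unfolding closure_sequential by blast
  then obtain x where "\<forall>n. u n = P (x n)"
    unfolding image_iff by metis
  with \<open>u \<longlonglongrightarrow> m\<close> have lim: "(\<lambda>n. P (x n)) \<longlonglongrightarrow> m"
    using ext[of u "\<lambda>n. P (x n)"] by blast
  have "dist (S (x i)) (S (x j)) = dist (P (x i)) (P (x j))" for i j
    using norm[of "x i - x j"] by (simp add: dist_norm bounded_clinear_simps[OF P] bounded_clinear_simps[OF S])
  then have "Cauchy (\<lambda>n. S (x n))"
    using LIMSEQ_imp_Cauchy[OF lim] unfolding Cauchy_def by simp
  then obtain z where "(\<lambda>n. S (x n)) \<longlonglongrightarrow> z"
    using Cauchy_convergent_iff convergent_def by blast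
  moreover have "P w \<in> closure (range P)" for w
    by (rule subsetD[OF closure_subset rangeI])
  ultimately show ?thesis
    unfolding polar_graph_def using lim orth by blast
qed

text \<open>\<open>W\<close> sends \<open>P x\<close> to \<open>S x\<close>, extends continuously to
  the closure of the range and vanishes on its orthogonal complement; the graph relation encodes all
  three at once.\<close>

theorem partial_isometry_exists:
  fixes P :: "'a::complex_hilbert_space \<Rightarrow> 'a" and S :: "'a \<Rightarrow> 'b::complex_hilbert_space"
  assumes pos: "positive_op P" and S: "bounded_clinear S"
    and norm: "\<And>x. norm (S x) = norm (P x)"
  obtains W where "partial_isometry W" "S = W \<circ> P" "kernel W = kernel P"
proof -
  have P: "bounded_clinear P"
    using pos by (simp add: positive_op_def)
  obtain proj W where G: "\<And>y. polar_graph P S y (proj y) (W y)"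
    using polar_graph_exists[OF P S norm] by metis
  \<comment> \<open>Subtracting two graph entries over \<open>y\<close> leaves an entry over
    \<open>0\<close>, and the norm bounds force both its components to be zero.\<close>
  have unique: "z = W y \<and> m = proj y" if "polar_graph P S y m z" for y m z
  proof -
    have "polar_graph P S (y + (-1) *\<^sub>C y) (m + (-1) *\<^sub>C proj y) (z + (-1) *\<^sub>C W y)"
      by (rule polar_graph_add_scaleC[OF P S that G])
    then have "polar_graph P S 0 (m - proj y) (z - W y)"
      by simp
    then show ?thesis
      using polar_graph_norm[where y = 0, OF norm] by fastforce
  qed
  have lin: "W (y + c *\<^sub>C y') = W y + c *\<^sub>C W y'" for y y' c
    using unique[OF polar_graph_add_scaleC[OF P S G G]] by metis
  have "polar_graph P S 0 0 0"
    unfolding polar_graph_def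
    by (auto intro!: exI[of _ "\<lambda>_. 0"] simp: bounded_clinear_simps[OF P] bounded_clinear_simps[OF S])
  then have W0: "W 0 = 0"
    using unique by metis
  have W_scaleC: "W (c *\<^sub>C y) = c *\<^sub>C W y" for c y
    using lin[of 0 c y] by (simp add: W0)
  have "bounded_linear W"
  proof (rule bounded_linear_intro[of _ 1])
    show "W (x + y) = W x + W y" for x y
      using lin[of x 1 y] by simp
    show "W (r *\<^sub>R x) = r *\<^sub>R W x" for r x
      by (simp add: scaleR_scaleC W_scaleC)
    show "norm (W x) \<le> norm x * 1" for x
      using polar_graph_norm(2)[OF norm G] by simp
  qed
  then have W: "bounded_clinear W"
    by (simp add: bounded_clinear_def W_scaleC)
  \<comment> \<open>The projection vanishes exactly when \<open>y\<close> is orthogonal to the range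
    of \<open>P\<close>, that is, when \<open>y\<close> lies in the kernel.\<close>
  have proj_0: "proj y = 0 \<longleftrightarrow> P y = 0" for y
  proof
    assume "proj y = 0"
    then show "P y = 0"
      using G[of y] by (simp add: polar_graph_def positive_op_kernel_iff[OF pos])
  next
    assume "P y = 0"
    then have "polar_graph P S y 0 0"
      unfolding polar_graph_def
      by (auto intro!: exI[of _ "\<lambda>_. 0"] simp: bounded_clinear_simps[OF P] bounded_clinear_simps[OF S]
          positive_op_kernel_iff[OF pos])
    then show "proj y = 0"
      using unique by metis
  qed
  have W_0: "W y = 0 \<longleftrightarrow> P y = 0" for y
    using polar_graph_norm(1)[OF norm G, of y] proj_0[of y] by (metis norm_eq_zero)
  \<comment> \<open>The vector \<open>y - proj y\<close> lies in the kernel, hence is orthogonal to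
    \<open>y\<close>; it is also orthogonal to \<open>proj y\<close>. So \<open>y = proj y\<close>
    and the norms agree.\<close>
  have "norm (W y) = norm y" if orth: "\<forall>v\<in>kernel W. cinner y v = 0" for y
  proof -
    have "P (y - proj y) = 0"
      using G[of y] by (simp add: polar_graph_def positive_op_kernel_iff[OF pos])
    then have "cinner (y - proj y) y = 0"
      using orth W_0 cinner_eq_0_commute unfolding kernel_def by blast
    then have "cinner (y - proj y) (y - proj y) = 0"
      using polar_graph_orthogonal[OF G, of y] by (simp add: cinner_diff_right)
    then show ?thesis
      using polar_graph_norm(1)[OF norm G, of y] by simp
  qed
  then have "partial_isometry W"
    using W by (simp add: partial_isometry_def)
  moreover have "S = W \<circ> P"
  proof
    fix x
    \<comment> \<open>A constant sequence suffices, since \<open>P x\<close> lies in the range and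
      is its own projection.\<close>
    have "polar_graph P S (P x) (P x) (S x)"
      unfolding polar_graph_def by (auto intro!: exI[of _ "\<lambda>_. x"])
    then show "S x = (W \<circ> P) x"
      using unique by (metis comp_apply)
  qed
  moreover have "kernel W = kernel P"
    by (simp add: kernel_def W_0)
  ultimately show thesis
    using that by blast
qed

section \<open>Joint polar decomposition and the spherical Aluthge transform\<close>

lemma bounded_clinear_column:
  assumes "bounded_clinear (fst T)" "bounded_clinear (snd T)"
  shows "bounded_clinear (column T)"
proof -
  have "column T = (\<lambda>x. (fst T x, snd T x))"
    by (rule ext) (simp add: column_def)
  then show ?thesis
    using assms by (auto simp: bounded_clinear_def scaleC_prod_def intro: bounded_linear_Pair)
qed

lemma kernel_column: "kernel (column T) = kernel (fst T) \<inter> kernel (snd T)"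
  by (auto simp: kernel_def column_def zero_prod_def)

text \<open>The quadratic form of the operator under the root is the squared norm of the column; by
  symmetry of the root it is also the squared norm of the modulus.\<close>

lemma joint_modulus:
  fixes T :: "'h::complex_hilbert_space op_pair"
  assumes T: "bounded_clinear (fst T)" "bounded_clinear (snd T)"
  shows "positive_op (joint_modulus T)" "norm (joint_modulus T x) = norm (column T x)"
proof -
  let ?A = "\<lambda>x. cadjoint (fst T) (fst T x) + cadjoint (snd T) (snd T x)"
  have A: "cinner (?A x) x = of_real ((norm (column T x))\<^sup>2)" for x
  proof -
    have "cinner x (?A x) = of_real ((norm (column T x))\<^sup>2)"
      by (simp add: cinner_add_right cadjoint[OF T(1), symmetric] cadjoint[OF T(2), symmetric]
          cinner_self column_def norm_prod_def)
    then show ?thesis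
      using cinner_commute[of "?A x" x] by simp
  qed
  have "bounded_clinear ?A"
    using T[THEN bounded_clinear_cadjoint] T unfolding bounded_clinear_def
    by (auto intro!: bounded_linear_add bounded_linear_compose[of "cadjoint _"] simp: scaleC_add_right)
  then have pos: "positive_op ?A"
    unfolding positive_op_def A by simp
  then show P: "positive_op (joint_modulus T)"
    unfolding joint_modulus_def by (rule sqrt_op)
  have "of_real ((norm (joint_modulus T x))\<^sup>2) = cinner (?A x) x"
    using sqrt_op(2)[OF pos, of x] positive_op_symmetric[OF P, of "joint_modulus T x" x]
    unfolding joint_modulus_def by (simp add: cinner_self)
  then have "complex_of_real ((norm (joint_modulus T x))\<^sup>2) = of_real ((norm (column T x))\<^sup>2)"
    unfolding A .
  then show "norm (joint_modulus T x) = norm (column T x)"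
    unfolding of_real_eq_iff by (simp add: power2_eq_iff_nonneg)
qed

text \<open>Equality of norms is what \<open>partial_isometry_exists\<close> asks for; the
  components of the resulting \<open>W\<close> form \<open>V\<close>.\<close>

lemma joint_polar_decomposition_exists:
  fixes T :: "'h::complex_hilbert_space op_pair"
  assumes T: "bounded_clinear (fst T)" "bounded_clinear (snd T)"
  shows "\<exists>V. joint_polar_decomposition T V (joint_modulus T)"
proof -
  obtain W where W: "partial_isometry W" "column T = W \<circ> joint_modulus T"
    "kernel W = kernel (joint_modulus T)"
    using partial_isometry_exists[OF joint_modulus(1)[OF T] bounded_clinear_column[OF T]
        joint_modulus(2)[OF T, symmetric]] by blast
  define V where "V = (fst \<circ> W, snd \<circ> W)"
  have V: "column V = W"
    by (rule ext) (simp add: column_def V_def)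
  have "kernel (column T) = kernel (joint_modulus T)"
    using joint_modulus(2)[OF T] by (auto simp: kernel_def) (metis norm_eq_zero)+
  then have "joint_polar_decomposition T V (joint_modulus T)"
    unfolding joint_polar_decomposition_def kernel_column[symmetric] V using W by simp
  then show ?thesis by blast
qed

text \<open>The choice ranges over pairs, and any pair it can select has the joint modulus as second
  component; only \<open>V\<close> remains unspecified.\<close>

lemma spherical_aluthge_eq:
  fixes T :: "'h::complex_hilbert_space op_pair"
  assumes T: "bounded_clinear (fst T)" "bounded_clinear (snd T)"
  obtains V where "joint_polar_decomposition T V (joint_modulus T)"
    "spherical_aluthge T = (let Q = sqrt_op (joint_modulus T) in (Q \<circ> fst V \<circ> Q, Q \<circ> snd V \<circ> Q))"
proof -
  obtain V P where VP: "(SOME (V, P). joint_polar_decomposition T V P) = (V, P)"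
    by fastforce
  have "\<exists>VP. case VP of (V, P) \<Rightarrow> joint_polar_decomposition T V P"
    using joint_polar_decomposition_exists[OF T] by auto
  then have "case (SOME (V, P). joint_polar_decomposition T V P) of
      (V, P) \<Rightarrow> joint_polar_decomposition T V P"
    by (rule someI_ex)
  then have "joint_polar_decomposition T V P"
    unfolding VP by simp
  moreover from this have "P = joint_modulus T"
    by (simp add: joint_polar_decomposition_def)
  ultimately show thesis
    using that[of V] by (simp add: spherical_aluthge_def VP)
qed

section \<open>Koszul exactness under a bijective intertwiner\<close>

lemma kernel_intertwined:
  assumes "A \<circ> Q = R \<circ> B" "surj Q" and R: "\<And>y. R y = 0 \<longleftrightarrow> y = 0"
  shows "kernel A = Q ` kernel B"
proof -
  have "A (Q x) = 0 \<longleftrightarrow> B x = 0" for x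
    using fun_cong[OF assms(1), of x] by (simp add: R)
  then show ?thesis
    unfolding kernel_def using surjD[OF assms(2)] by fastforce
qed

text \<open>\<open>Q\<close> on the outer terms and \<open>Q\<close> on each component of the middle
  term form an isomorphism of Koszul complexes, so kernels and ranges correspond and exactness
  transfers place by place.\<close>

lemma taylor_invertible_similarity:
  assumes Q: "bounded_clinear Q" "bij Q"
    and 1: "\<And>x. fst S (Q x) = Q (fst T x)" and 2: "\<And>x. snd S (Q x) = Q (snd T x)"
  shows "taylor_invertible T \<longleftrightarrow> taylor_invertible S"
proof -
  let ?QQ = "map_prod Q Q"
  have inj: "inj Q" and surj: "surj Q"
    using Q(2) by (simp_all add: bij_def)
  have Q0: "Q x = 0 \<longleftrightarrow> x = 0" for x
    using injD[OF inj, of x 0] bounded_clinear_simps(4)[OF Q(1)] by auto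
  have injQQ: "inj ?QQ"
    using prod.inj_map[OF inj inj] .
  have surjQQ: "range ?QQ = UNIV"
    using surj by (simp add: map_prod_surj)
  have col: "column S \<circ> Q = ?QQ \<circ> column T"
    by (rule ext) (simp add: column_def 1 2)
  have row: "koszul_row S \<circ> ?QQ = Q \<circ> koszul_row T"
    by (rule ext) (simp add: koszul_row_def 1 2 bounded_clinear_simps[OF Q(1)] split: prod.split)
  have "kernel (column S) = Q ` kernel (column T)"
    by (rule kernel_intertwined[OF col surj]) (auto simp: prod_eq_iff Q0)
  then have "kernel (column S) = {0} \<longleftrightarrow> kernel (column T) = {0}"
    using inj_image_eq_iff[OF inj, of "kernel (column T)" "{0}"]
    by (simp add: bounded_clinear_simps(4)[OF Q(1)])
  moreover have "range (column S) = ?QQ ` range (column T)"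
    using arg_cong[OF col, of range] unfolding image_comp[symmetric] surj .
  moreover have "kernel (koszul_row S) = ?QQ ` kernel (koszul_row T)"
    by (rule kernel_intertwined[OF row surjQQ Q0])
  moreover have "range (koszul_row S) = Q ` range (koszul_row T)"
    using arg_cong[OF row, of range] unfolding image_comp[symmetric] surjQQ .
  then have "range (koszul_row S) = UNIV \<longleftrightarrow> range (koszul_row T) = UNIV"
    using inj_image_eq_iff[OF inj, of "range (koszul_row T)" UNIV] surj by simp
  ultimately show ?thesis
    by (simp add: taylor_invertible_def inj_image_eq_iff[OF injQQ])
qed

lemma bij_joint_modulus_if_taylor_invertible:
  fixes T :: "'h::complex_hilbert_space op_pair"
  assumes T: "bounded_clinear (fst T)" "bounded_clinear (snd T)" and inv: "taylor_invertible T"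
  shows "bij (joint_modulus T)"
proof -
  let ?P = "joint_modulus T"
  note pos = joint_modulus(1)[OF T] and norm = joint_modulus(2)[OF T]
  have P: "bounded_clinear ?P"
    using pos by (simp add: positive_op_def)
  note col = bounded_clinear_column[OF T]
  have ker: "x = 0" if "?P x = 0" for x
  proof -
    have "x \<in> kernel (column T)"
      using that norm[of x] by (simp add: kernel_def)
    then show ?thesis
      using inv by (simp add: taylor_invertible_def)
  qed
  have "inj ?P"
    using bounded_clinear_injI[OF P ker] .
  \<comment> \<open>Exactness in the middle presents the range of the column as the kernel of a
    continuous map, hence as a closed set.\<close>
  have "continuous_on UNIV (koszul_row T)"
    unfolding koszul_row_def
    by (intro continuous_on_add continuous_on_minus continuous_on_fst continuous_on_snd
        continuous_on_id bounded_linear.continuous_on[OF bounded_clinearD(1)[OF T(1)]]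
        bounded_linear.continuous_on[OF bounded_clinearD(1)[OF T(2)]])
  then have "closed (kernel (koszul_row T))"
    unfolding kernel_def by (intro closed_Collect_eq continuous_on_const)
  then have closed_col: "closed (range (column T))"
    using inv by (simp add: taylor_invertible_def)
  have diff: "norm (?P x - ?P y) = norm (column T x - column T y)" for x y
    using norm[of "x - y"] by (simp add: bounded_clinear_simps[OF P] bounded_clinear_simps[OF col])
  have "closed (range ?P)"
    unfolding closed_sequential_limits
  proof safe
    fix u l assume "\<forall>n::nat. u n \<in> range ?P" and u: "u \<longlonglongrightarrow> l"
    then obtain x where x: "u = (\<lambda>n. ?P (x n))"
      unfolding image_iff by (auto simp: fun_eq_iff dest!: choice)
    \<comment> \<open>By \<open>diff\<close>, convergence of \<open>P (x n)\<close> makes the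
      columns Cauchy; their limit \<open>column T y\<close> provides the preimage \<open>y\<close>
      of \<open>l\<close>.\<close>
    have "Cauchy (\<lambda>n. column T (x n))"
      using LIMSEQ_imp_Cauchy[OF u] unfolding Cauchy_def x dist_norm diff .
    then obtain z where z: "(\<lambda>n. column T (x n)) \<longlonglongrightarrow> z"
      using Cauchy_convergent_iff convergent_def by blast
    then have "z \<in> range (column T)"
      using closed_sequentially[OF closed_col _ z] by blast
    then obtain y where y: "z = column T y"
      by blast
    have "(\<lambda>n. norm (?P (x n) - ?P y)) \<longlonglongrightarrow> 0"
      unfolding diff using tendsto_norm_zero[OF LIM_zero[OF z]] by (simp add: y)
    then have "u \<longlonglongrightarrow> ?P y"
      unfolding x by (rule LIM_zero_cancel[OF tendsto_norm_zero_cancel])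
    then have "l = ?P y"
      by (rule LIMSEQ_unique[OF u])
    then show "l \<in> range ?P"
      by blast
  qed
  \<comment> \<open>A vector orthogonal to the range of a symmetric operator lies in its kernel,
    which is trivial here.\<close>
  then have "range ?P = UNIV"
    by (rule closed_subspace_eq_UNIV[OF subspace_range[OF P]])
      (simp add: ker positive_op_kernel_iff[OF pos])
  with \<open>inj ?P\<close> show ?thesis
    by (simp add: bij_def)
qed

theorem theorem2p2:
  fixes T :: "('h::complex_hilbert_space) op_pair"
  assumes infinite_dim: "\<not> (\<exists>B :: 'h set. finite B \<and> complex_vector.span B = UNIV)"
    and comm: "commuting_pair T"
  shows "taylor_invertible T \<longleftrightarrow> taylor_invertible (spherical_aluthge T)"
proof -
  have T: "bounded_clinear (fst T)" "bounded_clinear (snd T)"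
    using comm by (simp_all add: commuting_pair_def)
  obtain V where V: "joint_polar_decomposition T V (joint_modulus T)"
    and S: "spherical_aluthge T =
      (let Q = sqrt_op (joint_modulus T) in (Q \<circ> fst V \<circ> Q, Q \<circ> snd V \<circ> Q))"
    using spherical_aluthge_eq[OF T] .
  define Q where "Q = sqrt_op (joint_modulus T)"
  have QQ: "Q (Q x) = joint_modulus T x" for x
    unfolding Q_def by (rule sqrt_op(2)[OF joint_modulus(1)[OF T]])
  have Q: "bounded_clinear Q"
    using sqrt_op(1)[OF joint_modulus(1)[OF T]] by (simp add: positive_op_def Q_def)
  have fst_S: "fst (spherical_aluthge T) x = Q (fst V (Q x))"
    and snd_S: "snd (spherical_aluthge T) x = Q (snd V (Q x))" for x
    by (simp_all add: S Q_def Let_def)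
  have "column T x = column V (Q (Q x))" for x
    using V unfolding joint_polar_decomposition_def QQ by (metis comp_apply)
  then have TV: "fst T x = fst V (Q (Q x))" "snd T x = snd V (Q (Q x))" for x
    by (simp_all add: column_def)
  have similar: "taylor_invertible T \<longleftrightarrow> taylor_invertible (spherical_aluthge T)" if "bij Q"
    by (rule taylor_invertible_similarity[OF Q that]) (simp_all add: fst_S snd_S TV)
  have "bij Q" if "taylor_invertible T"
  proof -
    \<comment> \<open>Bijectivity of a composite makes its inner factor injective and its outer
      factor surjective; here both are \<open>Q\<close>.\<close>
    have "bij (Q \<circ> Q)"
      using bij_joint_modulus_if_taylor_invertible[OF T that] by (simp add: comp_def QQ)
    then show ?thesis
      using inj_on_imageI2[of Q Q UNIV] unfolding bij_def by (auto simp: image_comp[symmetric])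
  qed
  moreover have "bij Q" if inv: "taylor_invertible (spherical_aluthge T)"
  proof -
    \<comment> \<open>Vanishing at zero is read off from the components of \<open>T\<close> through
      \<open>TV\<close>, since \<open>Q (Q 0) = 0\<close>.\<close>
    have V0: "fst V 0 = 0" "snd V 0 = 0"
      using TV[of 0] by (simp_all add: bounded_clinear_simps[OF Q] bounded_clinear_simps[OF T(1)]
          bounded_clinear_simps[OF T(2)])
    have "x = 0" if "Q x = 0" for x
    proof -
      have "x \<in> kernel (column (spherical_aluthge T))"
        using that by (simp add: kernel_def column_def fst_S snd_S V0 zero_prod_def
            bounded_clinear_simps[OF Q])
      then show ?thesis
        using inv by (simp add: taylor_invertible_def)
    qed
    then have "inj Q"
      by (rule bounded_clinear_injI[OF Q])
    \<comment> \<open>Pulling out the common left factor \<open>Q\<close> lets surjectivity pass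
      from the row to \<open>Q\<close>.\<close>
    have "koszul_row (spherical_aluthge T) z = Q (fst V (Q (snd z)) - snd V (Q (fst z)))" for z
      by (simp add: koszul_row_def fst_S snd_S bounded_clinear_simps[OF Q])
    then have "range (koszul_row (spherical_aluthge T)) \<subseteq> range Q"
      by auto
    then have "surj Q"
      using inv by (auto simp: taylor_invertible_def)
    with \<open>inj Q\<close> show ?thesis
      by (simp add: bij_def)
  qed
  ultimately show ?thesis
    using similar by blast
qed

end
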